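(* The functions $$f_1(\lambda)=\Theta_{\varepsilon_1}(\lambda)+\Theta_{\varepsilon_2}(\lambda),\quad f_2(\lambda)=\Theta_0(\lambda)+\Theta_{\varepsilon_1+\varepsilon_2}(\lambda),\quad f_3(\lambda)=\Theta_0(\lambda)-\Theta_{\varepsilon_1+\varepsilon_2}(\lambda)$$ are common eigenfunctions of $\widetilde{M_1}$ and $\widetilde{M_2}$: $$\widetilde{M_d}f_i(\lambda)=E_{d,i}f_i(\lambda)\qquad(d=1,2,\ i=1,2,3),$$ with eigenvalues $$E_{1,i}=\left(\frac{\theta_1(2\hbar)\,\theta_{i+1}(0)}{\theta_1(\hbar)\,\theta_{i+1}(\hbar)}\right)^2,\qquad E_{2,i}=2E_{1,i}.$$
   Context: Jacobi theta functions, for fixed $\tau$ in the upper half plane, $\theta_i(z)=\theta_i(z|\tau)$: $\theta_1(z)=\sum_{k\in\mathbb{Z}}\exp\left[2\pi i\left((z+\tfrac12)(k+\tfrac12)+\tfrac12(k+\tfrac12)^2\tau\right)\right]$, $\theta_2(z)=\sum_{k\in\mathbb{Z}}\exp\left[2\pi i\left(z(k+\tfrac12)+\tfrac12(k+\tfrac12)^2\tau\right)\right]$, $\theta_3(z)=\sum_{k\in\mathbb{Z}}\exp\left[2\pi i\left(zk+\tfrac{k^2}{2}\tau\right)\right]$, $\theta_4(z)=\sum_{k\in\mathbb{Z}}\exp\left[2\pi i\left((z+\tfrac12)k+\tfrac{k^2}{2}\tau\right)\right]$. Let $\mathfrak{h}^*=\mathbb{C}\varepsilon_1\oplus\mathbb{C}\varepsilon_2$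 with the symmetric bilinear form $(\varepsilon_j,\varepsilon_k)=\frac12\delta_{jk}$ (the dual Cartan subalgebra of $\mathfrak{sp}(4,\mathbb{C})$). For $\lambda,p\in\mathfrak{h}^*$ write $\lambda_p:=(\lambda,p)$. Weight lattice $P=\mathbb{Z}\varepsilon_1+\mathbb{Z}\varepsilon_2$, coroot lattice $Q^\vee=\mathbb{Z}2\varepsilon_1+\mathbb{Z}2\varepsilon_2$. For $\mu\in P$ the classical theta function is $$\Theta_\mu(\lambda)=\sum_{\gamma\in\mu+Q^\vee}\exp\left[2\pi i\left((\gamma,\lambda)+\frac{(\gamma,\gamma)}{2}\tau\right)\right],\qquad\lambda\in\mathfrak{h}^*.$$ Fix a generic complex parameter $\hbar$ (so that the denominators $\theta_1(\hbar)$, $\theta_{i+1}(\hbar)$ do not vanish). For $\beta\in\mathfrak{h}^*$, $T^\hbar_\beta f(\lambda):=f(\lambda+\hbar\beta)$. Let $\mathcal{P}_1=\{\pm\varepsilon_1,\pm\varepsilon_2\}$. The difference operators, acting on meromorphic functions on $\mathfrak{h}^*$, are $$\widetilde{M_1}=\sum_{p\in\mathcal{P}_1}\ \prod_{q\in\mathcal{P}_1,\,q\ne\pm p}\frac{\theta_1(\lambda_{p+q}-\hbar)}{\theta_1(\lambda_{p+q})}\,T^\hbar_{2p},$$ $$\widetilde{M_2}=\sum_{p=\pm\varepsilon_1,\ q=\pm\varepsilon_2}\left(\frac{\theta_1(\lambda_{p+q}-\hbar)}{\theta_1(\lambda_{p+q}+\hbar)}T^\hbar_{2p}T^\hbar_{2q}+\frac{\theta_1(\lambda_{p+q}-\hbar)\,\theta_1(\lambda_{p+q}+2\hbar)}{\theta_1(\lambda_{p+q})\,\theta_1(\lambda_{p+q}+\hbar)}\right).$$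 *)

theory Defs
  imports "HOL-Analysis.Analysis"
begin

definition theta1 :: "complex \<Rightarrow> complex \<Rightarrow> complex" where
  "theta1 \<tau> z = (\<Sum>\<^sub>\<infinity>k::int. exp (2 * of_real pi * \<i> *
     ((z + 1/2) * (of_int k + 1/2) + 1/2 * (of_int k + 1/2)^2 * \<tau>)))"

definition theta2 :: "complex \<Rightarrow> complex \<Rightarrow> complex" where
  "theta2 \<tau> z = (\<Sum>\<^sub>\<infinity>k::int. exp (2 * of_real pi * \<i> *
     (z * (of_int k + 1/2) + 1/2 * (of_int k + 1/2)^2 * \<tau>)))"

definition theta3 :: "complex \<Rightarrow> complex \<Rightarrow> complex" where
  "theta3 \<tau> z = (\<Sum>\<^sub>\<infinity>k::int. exp (2 * of_real pi * \<i> *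
     (z * of_int k + (of_int k)^2 / 2 * \<tau>)))"

definition theta4 :: "complex \<Rightarrow> complex \<Rightarrow> complex" where
  "theta4 \<tau> z = (\<Sum>\<^sub>\<infinity>k::int. exp (2 * of_real pi * \<i> *
     ((z + 1/2) * of_int k + (of_int k)^2 / 2 * \<tau>)))"

text \<open>Only the indices 1, 2, 3, 4 are meaningful.\<close>

definition theta :: "nat \<Rightarrow> complex \<Rightarrow> complex \<Rightarrow> complex" where
  "theta i = (if i = 1 then theta1 else if i = 2 then theta2
              else if i = 3 then theta3 else theta4)"

text \<open>The dual Cartan subalgebra of sp(4) is \<^typ>\<open>complex ^ 2\<close>, by coordinates with respect to
  the basis \<open>\<epsilon> 1, \<epsilon> 2\<close>; the form below is complex bilinear (not Hermitian).\<close>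

definition \<epsilon> :: "2 \<Rightarrow> complex ^ 2" where
  "\<epsilon> j = axis j 1"

definition form :: "complex ^ 2 \<Rightarrow> complex ^ 2 \<Rightarrow> complex" where
  "form x y = (\<Sum>j\<in>UNIV. \<Sum>k\<in>UNIV. x $ j * y $ k * (if j = k then 1/2 else 0))"

definition coroot_lattice :: "(complex ^ 2) set" where
  "coroot_lattice = {of_int m *s (2 *s \<epsilon> 1) + of_int n *s (2 *s \<epsilon> 2) | m n :: int. True}"

definition classical_Theta :: "complex \<Rightarrow> complex ^ 2 \<Rightarrow> complex ^ 2 \<Rightarrow> complex" where
  "classical_Theta \<tau> \<mu> x =
     (\<Sum>\<^sub>\<infinity>\<gamma>\<in>(\<lambda>\<beta>. \<mu> + \<beta>) ` coroot_lattice.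
        exp (2 * of_real pi * \<i> * (form \<gamma> x + form \<gamma> \<gamma> / 2 * \<tau>)))"

definition shift :: "complex \<Rightarrow> complex ^ 2 \<Rightarrow> (complex ^ 2 \<Rightarrow> complex) \<Rightarrow> complex ^ 2 \<Rightarrow> complex" where
  "shift h \<beta> f x = f (x + h *s \<beta>)"

definition P1 :: "(complex ^ 2) set" where
  "P1 = {\<epsilon> 1, - \<epsilon> 1, \<epsilon> 2, - \<epsilon> 2}"

text \<open>The operators are defined on all functions. Where a denominator vanishes the value is
  meaningless (division by zero yields 0), so identities between meromorphic functions are to be
  read on the sets \<open>M1_regular\<close> and \<open>M2_regular\<close>, the complements of the zero loci of
  the denominators.\<close>

definition M1 ::
  "complex \<Rightarrow> complex \<Rightarrow> (complex ^ 2 \<Rightarrow> complex) \<Rightarrow> complex ^ 2 \<Rightarrow> complex" where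
  "M1 \<tau> h f x =
     (\<Sum>p\<in>P1. (\<Prod>q\<in>{q \<in> P1. q \<noteq> p \<and> q \<noteq> - p}.
         theta 1 \<tau> (form x (p + q) - h) / theta 1 \<tau> (form x (p + q)))
       * shift h (2 *s p) f x)"

definition M2 ::
  "complex \<Rightarrow> complex \<Rightarrow> (complex ^ 2 \<Rightarrow> complex) \<Rightarrow> complex ^ 2 \<Rightarrow> complex" where
  "M2 \<tau> h f x =
     (\<Sum>p\<in>{\<epsilon> 1, - \<epsilon> 1}. \<Sum>q\<in>{\<epsilon> 2, - \<epsilon> 2}.
         theta 1 \<tau> (form x (p + q) - h) / theta 1 \<tau> (form x (p + q) + h)
           * shift h (2 *s p) (shift h (2 *s q) f) x
       + theta 1 \<tau> (form x (p + q) - h) * theta 1 \<tau> (form x (p + q) + 2 * h)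
           / (theta 1 \<tau> (form x (p + q)) * theta 1 \<tau> (form x (p + q) + h))
           * f x)"

definition M1_regular :: "complex \<Rightarrow> (complex ^ 2) set" where
  "M1_regular \<tau> =
     {x. \<forall>p\<in>P1. \<forall>q\<in>P1. q \<noteq> p \<and> q \<noteq> - p \<longrightarrow> theta 1 \<tau> (form x (p + q)) \<noteq> 0}"

definition M2_regular :: "complex \<Rightarrow> complex \<Rightarrow> (complex ^ 2) set" where
  "M2_regular \<tau> h =
     {x. \<forall>p\<in>{\<epsilon> 1, - \<epsilon> 1}. \<forall>q\<in>{\<epsilon> 2, - \<epsilon> 2}.
        theta 1 \<tau> (form x (p + q)) \<noteq> 0 \<and> theta 1 \<tau> (form x (p + q) + h) \<noteq> 0}"

text \<open>Only the indices 1, 2, 3 are meaningful.\<close>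

definition f_fun :: "complex \<Rightarrow> nat \<Rightarrow> complex ^ 2 \<Rightarrow> complex" where
  "f_fun \<tau> i x =
     (if i = 1 then classical_Theta \<tau> (\<epsilon> 1) x + classical_Theta \<tau> (\<epsilon> 2) x
      else if i = 2 then classical_Theta \<tau> 0 x + classical_Theta \<tau> (\<epsilon> 1 + \<epsilon> 2) x
      else classical_Theta \<tau> 0 x - classical_Theta \<tau> (\<epsilon> 1 + \<epsilon> 2) x)"

definition E1 :: "complex \<Rightarrow> complex \<Rightarrow> nat \<Rightarrow> complex" where
  "E1 \<tau> h i =
     ((theta 1 \<tau> (2 * h) * theta (i + 1) \<tau> 0) / (theta 1 \<tau> h * theta (i + 1) \<tau> h))^2"

definition E2 :: "complex \<Rightarrow> complex \<Rightarrow> nat \<Rightarrow> complex" where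
  "E2 \<tau> h i = 2 * E1 \<tau> h i"

end

theory Submission
  imports Defs
begin

text \<open>
  For \<open>x = x\<^sub>1 \<epsilon>\<^sub>1 + x\<^sub>2 \<epsilon>\<^sub>2\<close>, in the coordinates \<open>u = (x\<^sub>1 + x\<^sub>2) / 2\<close> and \<open>v = (x\<^sub>1 - x\<^sub>2) / 2\<close>, the
  problem separates. The index set of the series \<open>f\<^sub>i\<close>, a union of two cosets of the coroot lattice,
  becomes a product of two one-dimensional index sets, so \<open>f\<^sub>i = g(u) g(v)\<close> with
  \<open>g = \<theta>\<^sub>i\<^sub>+\<^sub>1\<close> (\<open>f_fun_eq\<close>). The first operator maps such a product to \<open>A(u) A(v)\<close>, where \<open>A\<close> involves
  \<open>g\<close> only through \<open>\<theta>\<^sub>1(w - h) g(w + h) + \<theta>\<^sub>1(w + h) g(w - h)\<close>; the second maps it to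
  \<open>D(u) g(v) + g(u) D(v)\<close>, where \<open>D\<close> is what the operator \<open>g \<mapsto> A\<close> gives when it is applied twice
  (\<open>M1_of_product\<close>, \<open>M2_of_product\<close>). Everything therefore follows from one identity in a single
  variable, \<open>theta_exchange\<close>:
  \<open>\<theta>\<^sub>1(w - h) g(w + h) + \<theta>\<^sub>1(w + h) g(w - h) = C \<theta>\<^sub>1(w) g(w)\<close> with
  \<open>C = \<theta>\<^sub>1(2h) g(0) / (\<theta>\<^sub>1(h) g(h))\<close>. It gives \<open>A = C g\<close> and \<open>D = C\<^sup>2 g\<close>, hence the eigenvalues \<open>C\<^sup>2\<close>
  and \<open>2 C\<^sup>2\<close>.

  The identity holds because its left side is a function of \<open>w\<close> times a function of \<open>h\<close>; the
  constant is then read off at \<open>h = 0\<close> and at \<open>w = h\<close>. Both this separation of variables and the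
  factorisation of \<open>f\<^sub>i\<close> come from \<open>parity_theta_duplication\<close>, the classical relation between products
  of theta functions at \<open>\<tau>\<close> and at \<open>2\<tau>\<close>, which expresses the substitution
  \<open>(a, b) \<mapsto> (a + b, a - b)\<close> on the index lattice.
\<close>

section \<open>Theta series over a parity class\<close>

text \<open>
  The index runs over all integers, with \<open>a = 2k\<close> for the integral and \<open>a = 2k + 1\<close> for the
  half-integral characteristic, so that the substitution \<open>(a, b) \<mapsto> (a + b, a - b)\<close> stays within
  the integers and the characteristic is a condition on parity.
\<close>

definition gauss_term :: "complex \<Rightarrow> complex \<Rightarrow> int \<Rightarrow> complex" where
  "gauss_term \<tau> z a = exp (of_real pi * \<i> * (of_int a * z + (of_int a)^2 / 4 * \<tau>))"

definition parity_class :: "bool \<Rightarrow> int set" where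
  "parity_class e = {a. even a = e}"

definition parity_theta :: "bool \<Rightarrow> complex \<Rightarrow> complex \<Rightarrow> complex" where
  "parity_theta e \<tau> z = (\<Sum>\<^sub>\<infinity>a\<in>parity_class e. gauss_term \<tau> z a)"

lemma norm_gauss_term:
  "norm (gauss_term \<tau> z a) = exp (- pi * (real_of_int a * Im z + (real_of_int a)^2 / 4 * Im \<tau>))"
proof -
  have *: "(of_int a :: complex)^2 / 4 = of_real ((real_of_int a)^2 / 4)"
    by simp
  show ?thesis
    unfolding gauss_term_def * by (simp add: algebra_simps)
qed

text \<open>
  From \<open>n \<ge> (B + 1) / D\<close> on the exponent is at most \<open>- n\<close>, and a geometric series dominates.
\<close>

lemma summable_exp_quadratic:
  fixes B D :: real
  assumes "D > 0"
  shows "summable (\<lambda>n::nat. exp (B * real n - D * (real n)^2))"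
proof (rule summable_comparison_test_ev)
  show "eventually (\<lambda>n. norm (exp (B * real n - D * (real n)^2)) \<le> exp (- 1) ^ n) sequentially"
  proof (rule eventually_mono[OF eventually_ge_at_top[of "nat \<lceil>(B + 1) / D\<rceil>"]])
    fix n :: nat
    assume "n \<ge> nat \<lceil>(B + 1) / D\<rceil>"
    then have "(B + 1) / D \<le> real n"
      by linarith
    then have "B + 1 \<le> D * real n"
      using assms by (simp add: field_simps)
    then have "(B + 1) * real n \<le> (D * real n) * real n"
      by (intro mult_right_mono) auto
    then have "B * real n - D * (real n)^2 \<le> - real n"
      by (simp add: algebra_simps power2_eq_square)
    then show "norm (exp (B * real n - D * (real n)^2)) \<le> exp (- 1) ^ n"
      by (simp flip: exp_of_nat_mult)
  qed
  show "summable (\<lambda>n. exp (- 1 :: real) ^ n)"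
    by (rule summable_geometric) simp
qed

lemma gauss_term_summable:
  assumes "Im \<tau> > 0"
  shows "gauss_term \<tau> z summable_on A"
proof -
  have sgn: "(\<lambda>n::nat. gauss_term \<tau> z (s * int n)) summable_on UNIV" if "s^2 = 1" for s
  proof (rule norm_summable_imp_summable_on)
    have "(real_of_int s)^2 = 1"
      using that by (metis of_int_1 of_int_power)
    then have "norm (gauss_term \<tau> z (s * int n))
        = exp ((- pi * real_of_int s * Im z) * real n - (pi / 4 * Im \<tau>) * (real n)^2)" for n
      by (simp add: norm_gauss_term power_mult_distrib algebra_simps)
    then show "summable (\<lambda>n. norm (gauss_term \<tau> z (s * int n)))"
      using summable_exp_quadratic[of "pi / 4 * Im \<tau>" "- pi * real_of_int s * Im z"] assms
      by simp
  qed
  have rng: "gauss_term \<tau> z summable_on range (\<lambda>n::nat. s * int n)" if "s^2 = 1" for s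
  proof (subst summable_on_reindex)
    show "inj (\<lambda>n::nat. s * int n)"
      using that by (auto simp: inj_on_def)
  qed (use sgn[OF that] in \<open>simp add: o_def\<close>)
  have "a \<in> range (\<lambda>n::nat. 1 * int n) \<union> range (\<lambda>n::nat. -1 * int n)" for a
    by (cases a rule: int_cases2) auto
  then have "UNIV = range (\<lambda>n::nat. 1 * int n) \<union> range (\<lambda>n::nat. -1 * int n)"
    by blast
  moreover have "gauss_term \<tau> z summable_on
      (range (\<lambda>n::nat. 1 * int n) \<union> range (\<lambda>n::nat. -1 * int n))"
    by (intro summable_on_union rng) auto
  ultimately show ?thesis
    by (metis summable_on_subset_banach subset_UNIV)
qed

lemma has_sum_parity_theta_mult:
  assumes "Im \<tau> > 0" "Im \<tau>' > 0"
  shows "((\<lambda>(a, b). gauss_term \<tau> x a * gauss_term \<tau>' y b) has_sum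
           (parity_theta r \<tau> x * parity_theta s \<tau>' y)) (parity_class r \<times> parity_class s)"
proof (rule has_sum_SigmaI)
  let ?A = "parity_class r" and ?B = "parity_class s"
  note sum1 = gauss_term_summable[OF assms(1)] and sum2 = gauss_term_summable[OF assms(2)]
  show "((\<lambda>b. case (a, b) of (a, b) \<Rightarrow> gauss_term \<tau> x a * gauss_term \<tau>' y b) has_sum
      gauss_term \<tau> x a * parity_theta s \<tau>' y) ?B" for a
    using has_sum_cmult_right[OF has_sum_infsum[OF sum2[of y ?B]]]
    by (simp add: parity_theta_def)
  show "((\<lambda>a. gauss_term \<tau> x a * parity_theta s \<tau>' y) has_sum
      parity_theta r \<tau> x * parity_theta s \<tau>' y) ?A"
    using has_sum_cmult_left[OF has_sum_infsum[OF sum1[of x ?A]]]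
    by (simp add: parity_theta_def)
  have abs1: "(\<lambda>a. norm (gauss_term \<tau> x a)) summable_on ?A"
    using sum1 summable_on_iff_abs_summable_on_complex by blast
  have abs2: "(\<lambda>b. norm (gauss_term \<tau>' y b)) summable_on ?B"
    using sum2 summable_on_iff_abs_summable_on_complex by blast
  have "(\<lambda>p. norm (case p of (a, b) \<Rightarrow> gauss_term \<tau> x a * gauss_term \<tau>' y b))
      summable_on (?A \<times> ?B)"
  proof (rule summable_on_SigmaI)
    show "((\<lambda>b. norm (case (a, b) of (a, b) \<Rightarrow> gauss_term \<tau> x a * gauss_term \<tau>' y b)) has_sum
        norm (gauss_term \<tau> x a) * (\<Sum>\<^sub>\<infinity>b\<in>?B. norm (gauss_term \<tau>' y b))) ?B" for a
      using has_sum_cmult_right[OF has_sum_infsum[OF abs2]] by (simp add: norm_mult)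
    show "(\<lambda>a. norm (gauss_term \<tau> x a) * (\<Sum>\<^sub>\<infinity>b\<in>?B. norm (gauss_term \<tau>' y b))) summable_on ?A"
      by (intro summable_on_cmult_left abs1)
  qed auto
  then show "(\<lambda>(a, b). gauss_term \<tau> x a * gauss_term \<tau>' y b) summable_on (?A \<times> ?B)"
    by (rule abs_summable_summable)
qed

text \<open>
  The pairs \<open>(s, d)\<close> with both entries of parity \<open>e\<close> are the pairs \<open>(a + b, a - b)\<close> for which
  \<open>a + b\<close> has parity \<open>e\<close>. Splitting these by the parity of \<open>b\<close> gives the two products on the
  right, and \<open>s\<^sup>2 + d\<^sup>2 = 2 (a\<^sup>2 + b\<^sup>2)\<close> accounts for the doubled modulus.
\<close>

lemma parity_theta_duplication:
  assumes "Im \<tau> > 0"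
  shows "parity_theta e \<tau> u * parity_theta e \<tau> v =
           parity_theta e (2 * \<tau>) (u + v) * parity_theta True (2 * \<tau>) (u - v) +
           parity_theta (\<not> e) (2 * \<tau>) (u + v) * parity_theta False (2 * \<tau>) (u - v)"
proof -
  let ?g = "\<lambda>(s, d). gauss_term \<tau> u s * gauss_term \<tau> v d"
  let ?h = "\<lambda>(a, b). gauss_term (2 * \<tau>) (u + v) a * gauss_term (2 * \<tau>) (u - v) b"
  let ?T = "parity_class e \<times> parity_class True \<union> parity_class (\<not> e) \<times> parity_class False"
  have im: "Im (2 * \<tau>) > 0"
    using assms by simp
  have "(?h has_sum (parity_theta e (2 * \<tau>) (u + v) * parity_theta True (2 * \<tau>) (u - v) +
      parity_theta (\<not> e) (2 * \<tau>) (u + v) * parity_theta False (2 * \<tau>) (u - v))) ?T"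
    by (intro has_sum_Un_disjoint has_sum_parity_theta_mult im) (auto simp: parity_class_def)
  moreover have "(?g has_sum (parity_theta e \<tau> u * parity_theta e \<tau> v))
      (parity_class e \<times> parity_class e)"
    by (intro has_sum_parity_theta_mult assms)
  moreover have "infsum ?g (parity_class e \<times> parity_class e) = infsum ?h ?T"
  proof (rule infsum_reindex_bij_witness
      [where i = "\<lambda>(a, b). (a + b, a - b)" and j = "\<lambda>(s, d). ((s + d) div 2, (s - d) div 2)"])
    fix p :: "int \<times> int"
    assume p: "p \<in> parity_class e \<times> parity_class e"
    obtain s d where sd: "p = (s, d)"
      by (cases p)
    have "even (s + d)"
      using p by (auto simp: sd parity_class_def)
    then obtain a where a: "s + d = 2 * a"
      by blast
    define b where "b = s - a"
    have s: "s = a + b" and d: "d = a - b"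
      using a by (auto simp: b_def)
    have arg: "of_int (a + b) * u + (of_int (a + b))^2 / 4 * \<tau> +
        (of_int (a - b) * v + (of_int (a - b))^2 / 4 * \<tau>) =
        of_int a * (u + v) + (of_int a)^2 / 4 * (2 * \<tau>) +
        (of_int b * (u - v) + (of_int b)^2 / 4 * (2 * \<tau>))"
      by (simp add: power2_eq_square field_simps)
    show "(case (case p of (s, d) \<Rightarrow> ((s + d) div 2, (s - d) div 2)) of (a, b) \<Rightarrow> (a + b, a - b)) = p"
      and "(case p of (s, d) \<Rightarrow> ((s + d) div 2, (s - d) div 2)) \<in> ?T"
      using p by (auto simp: sd s d parity_class_def)
    have "gauss_term \<tau> u (a + b) * gauss_term \<tau> v (a - b)
        = gauss_term (2 * \<tau>) (u + v) a * gauss_term (2 * \<tau>) (u - v) b"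
      unfolding gauss_term_def exp_add[symmetric] distrib_left[symmetric] arg ..
    then show "?h (case p of (s, d) \<Rightarrow> ((s + d) div 2, (s - d) div 2)) = ?g p"
      by (simp add: sd s d)
  next
    fix p :: "int \<times> int"
    assume p: "p \<in> ?T"
    then show "(case (case p of (a, b) \<Rightarrow> (a + b, a - b)) of
        (s, d) \<Rightarrow> ((s + d) div 2, (s - d) div 2)) = p"
      by (auto split: prod.splits)
    show "(case p of (a, b) \<Rightarrow> (a + b, a - b)) \<in> parity_class e \<times> parity_class e"
      using p by (auto simp: parity_class_def)
  qed
  ultimately show ?thesis
    by (simp add: infsumI)
qed

section \<open>Translation and reflection of the theta functions\<close>

lemma theta2_eq_parity_theta: "theta2 \<tau> z = parity_theta False \<tau> z"
  unfolding theta2_def parity_theta_def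
proof (rule infsum_reindex_bij_witness[where i = "\<lambda>a. a div 2" and j = "\<lambda>k. 2 * k + 1"])
  fix k :: int
  have arg: "pi * \<i> * (of_int (2 * k + 1) * z + (of_int (2 * k + 1))^2 / 4 * \<tau>) =
      2 * of_real pi * \<i> * (z * (of_int k + 1/2) + 1/2 * (of_int k + 1/2)^2 * \<tau>)"
    by (simp add: power2_eq_square field_simps)
  show "gauss_term \<tau> z (2 * k + 1) =
      exp (2 * of_real pi * \<i> * (z * (of_int k + 1/2) + 1/2 * (of_int k + 1/2)^2 * \<tau>))"
    unfolding gauss_term_def arg ..
qed (auto simp: parity_class_def)

lemma theta3_eq_parity_theta: "theta3 \<tau> z = parity_theta True \<tau> z"
  unfolding theta3_def parity_theta_def
proof (rule infsum_reindex_bij_witness[where i = "\<lambda>a. a div 2" and j = "\<lambda>k. 2 * k"])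
  fix k :: int
  have arg: "pi * \<i> * (of_int (2 * k) * z + (of_int (2 * k))^2 / 4 * \<tau>) =
      2 * of_real pi * \<i> * (z * of_int k + (of_int k)^2 / 2 * \<tau>)"
    by (simp add: power2_eq_square field_simps)
  show "gauss_term \<tau> z (2 * k) =
      exp (2 * of_real pi * \<i> * (z * of_int k + (of_int k)^2 / 2 * \<tau>))"
    unfolding gauss_term_def arg ..
qed (auto simp: parity_class_def)

lemma theta1_eq_parity_theta: "theta1 \<tau> z = parity_theta False \<tau> (z + 1/2)"
  unfolding theta2_eq_parity_theta[symmetric] theta1_def theta2_def ..

lemma theta4_eq_parity_theta: "theta4 \<tau> z = parity_theta True \<tau> (z + 1/2)"
  unfolding theta3_eq_parity_theta[symmetric] theta3_def theta4_def ..

lemmas theta_eq_parity_theta =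
  theta1_eq_parity_theta theta2_eq_parity_theta theta3_eq_parity_theta theta4_eq_parity_theta

lemma exp_i_pi_int: "exp (of_real pi * \<i> * of_int a) = (if even a then 1 else - 1)"
proof (cases "even a")
  case True
  then obtain k where "a = 2 * k" by blast
  then have "of_real pi * \<i> * of_int a = 2 * of_int k * of_real pi * \<i>"
    by (simp add: mult_ac)
  then show ?thesis
    using True exp_integer_2pi[of "of_int k"] by (simp add: mult_ac)
next
  case False
  then obtain k where "a = 2 * k + 1" by (blast elim: oddE)
  then have "of_real pi * \<i> * of_int a = 2 * of_int k * of_real pi * \<i> + of_real pi * \<i>"
    by (simp add: algebra_simps)
  then show ?thesis
    using False exp_integer_2pi[of "of_int k"] by (simp add: exp_add mult_ac)
qed

lemma parity_theta_add_1:
  "parity_theta e \<tau> (z + 1) = (if e then 1 else - 1) * parity_theta e \<tau> z"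
  unfolding parity_theta_def infsum_cmult_right'[symmetric]
proof (rule infsum_cong)
  fix a assume "a \<in> parity_class e"
  moreover have "gauss_term \<tau> (z + 1) a = exp (of_real pi * \<i> * of_int a) * gauss_term \<tau> z a"
    unfolding gauss_term_def exp_add[symmetric] by (simp add: algebra_simps)
  ultimately show "gauss_term \<tau> (z + 1) a = (if e then 1 else - 1) * gauss_term \<tau> z a"
    by (simp add: exp_i_pi_int parity_class_def)
qed

lemma parity_theta_minus: "parity_theta e \<tau> (- z) = parity_theta e \<tau> z"
  unfolding parity_theta_def
  by (rule infsum_reindex_bij_witness[where i = uminus and j = uminus])
     (auto simp: parity_class_def gauss_term_def)

text \<open>
  \<open>\<theta>\<^sub>1\<close> is \<open>\<theta>\<^sub>2\<close> moved by half a period, and \<open>\<theta>\<^sub>2\<close> is even and changes sign under a full period.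
\<close>

lemma theta1_minus: "theta1 \<tau> (- z) = - theta1 \<tau> z"
  using parity_theta_minus[of False \<tau> "z - 1/2"] parity_theta_add_1[of False \<tau> "z - 1/2"]
  by (simp add: theta1_eq_parity_theta add.commute)

lemma theta1_0: "theta1 \<tau> 0 = 0"
  using theta1_minus[of \<tau> 0] by simp

lemma theta4_minus: "theta4 \<tau> (- z) = theta4 \<tau> z"
  using parity_theta_minus[of True \<tau> "z - 1/2"] parity_theta_add_1[of True \<tau> "z - 1/2"]
  by (simp add: theta4_eq_parity_theta add.commute)

text \<open>
  The half period and the shift of the modulus multiply the term of index \<open>k\<close> by
  \<open>exp(\<pi>\<i> k)\<close> and \<open>exp(\<pi>\<i> k\<^sup>2)\<close>, and \<open>k + k\<^sup>2\<close> is even.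
\<close>

lemma theta4_modular_shift: "theta4 (\<tau> + 1) z = theta3 \<tau> z"
proof -
  have "exp (2 * of_real pi * \<i> * ((z + 1/2) * of_int k + (of_int k)^2 / 2 * (\<tau> + 1))) =
      exp (2 * of_real pi * \<i> * (z * of_int k + (of_int k)^2 / 2 * \<tau>))" for k :: int
  proof -
    have arg: "2 * of_real pi * \<i> * ((z + 1/2) * of_int k + (of_int k)^2 / 2 * (\<tau> + 1)) =
       2 * of_real pi * \<i> * (z * of_int k + (of_int k)^2 / 2 * \<tau>)
         + of_real pi * \<i> * of_int (k + k^2)"
      by (simp add: field_simps)
    show ?thesis
      unfolding arg exp_add exp_i_pi_int by simp
  qed
  then show ?thesis
    by (simp only: theta4_def theta3_def)
qed

text \<open>
  The shift contributes \<open>exp(\<pi>\<i> (k + 1/2)\<^sup>2) = exp(\<pi>\<i> / 4) exp(\<pi>\<i> (k\<^sup>2 + k))\<close> to the term of index \<open>k\<close>,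
  and \<open>k\<^sup>2 + k\<close> is even.
\<close>

lemma theta1_modular_shift:
  "theta1 (\<tau> + 1) z = exp (of_real pi * \<i> / 4) * theta1 \<tau> z"
  unfolding theta1_def infsum_cmult_right'[symmetric]
proof (rule infsum_cong)
  fix k :: int
  have arg: "2 * of_real pi * \<i> *
      ((z + 1/2) * (of_int k + 1/2) + 1/2 * (of_int k + 1/2)^2 * (\<tau> + 1)) =
      of_real pi * \<i> / 4 + of_real pi * \<i> * of_int (k + k^2) + 2 * of_real pi * \<i> *
      ((z + 1/2) * (of_int k + 1/2) + 1/2 * (of_int k + 1/2)^2 * \<tau>)"
    by (simp add: field_simps power2_eq_square)
  show "exp (2 * of_real pi * \<i> *
      ((z + 1/2) * (of_int k + 1/2) + 1/2 * (of_int k + 1/2)^2 * (\<tau> + 1))) =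
      exp (of_real pi * \<i> / 4) * exp (2 * of_real pi * \<i> *
      ((z + 1/2) * (of_int k + 1/2) + 1/2 * (of_int k + 1/2)^2 * \<tau>))"
    unfolding arg exp_add exp_i_pi_int by simp
qed

section \<open>The exchange identity\<close>

text \<open>
  Duplication writes \<open>\<theta>\<^sub>1(x) \<theta>\<^sub>2(y)\<close> as a sum of two products in \<open>x + y = 2u\<close> and \<open>x - y = - 2h\<close>.
  Exchanging \<open>x\<close> and \<open>y\<close> reverses the sign of the second, in which \<open>h\<close> enters through the odd \<open>\<theta>\<^sub>1\<close>,
  and preserves the first.
\<close>

lemma theta1_theta2_exchange:
  assumes "Im \<tau> > 0"
  shows "theta1 \<tau> (u - h) * theta2 \<tau> (u + h) + theta1 \<tau> (u + h) * theta2 \<tau> (u - h) =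
           2 * theta1 (2 * \<tau>) (2 * u) * theta4 (2 * \<tau>) (2 * h)"
proof -
  have "theta1 \<tau> x * theta2 \<tau> y =
      theta1 (2 * \<tau>) (x + y) * theta4 (2 * \<tau>) (x - y) +
      theta4 (2 * \<tau>) (x + y) * theta1 (2 * \<tau>) (x - y)" for x y
    using parity_theta_duplication[OF assms, of False "x + 1/2" y]
    by (simp add: theta_eq_parity_theta algebra_simps)
  note this[of "u - h" "u + h"] this[of "u + h" "u - h"]
  moreover have "u - h - (u + h) = - (2 * h)" "u + h - (u - h) = 2 * h"
    "u - h + (u + h) = 2 * u" "u + h + (u - h) = 2 * u"
    by simp_all
  ultimately show ?thesis
    by (simp only: theta1_minus theta4_minus) (simp add: algebra_simps)
qed

text \<open>
  Here duplication is read from right to left: the left side is already the complete expansion of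
  a product at the modulus \<open>\<tau> / 2\<close>.
\<close>

lemma theta1_theta4_exchange:
  assumes "Im \<tau> > 0"
  shows "theta1 \<tau> (u - h) * theta4 \<tau> (u + h) + theta1 \<tau> (u + h) * theta4 \<tau> (u - h) =
           theta1 (\<tau> / 2) u * theta2 (\<tau> / 2) h"
  using parity_theta_duplication[of "\<tau> / 2" False "u + 1/2" h] assms
  by (simp add: theta_eq_parity_theta algebra_simps)

text \<open>
  The case of \<open>\<theta>\<^sub>3\<close> is that of \<open>\<theta>\<^sub>4\<close> at the modulus \<open>\<tau> + 1\<close>: this exchanges \<open>\<theta>\<^sub>3\<close> and \<open>\<theta>\<^sub>4\<close> and
  multiplies \<open>\<theta>\<^sub>1\<close> by a constant. Only the separation of variables matters below, so the factors
  may differ from case to case.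
\<close>

lemma theta_exchange_separates:
  assumes "Im \<tau> > 0" "j \<in> {2, 3, 4}"
  obtains F G where "\<And>u h. theta1 \<tau> (u - h) * theta j \<tau> (u + h) +
    theta1 \<tau> (u + h) * theta j \<tau> (u - h) = F u * G h"
proof -
  consider "j = 2" | "j = 3" | "j = 4"
    using assms(2) by auto
  then show thesis
  proof cases
    case 1
    show thesis
      by (rule that[of "\<lambda>u. 2 * theta1 (2 * \<tau>) (2 * u)" "\<lambda>h. theta4 (2 * \<tau>) (2 * h)"])
         (use theta1_theta2_exchange[OF assms(1)] in \<open>simp add: 1 theta_def\<close>)
  next
    case 2
    let ?c = "exp (- (of_real pi * \<i> / 4))"
    have c: "theta1 \<tau> z = ?c * theta1 (\<tau> + 1) z" for z
      by (simp add: theta1_modular_shift flip: exp_add mult.assoc)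
    show thesis
    proof (rule that[of "\<lambda>u. ?c * theta1 ((\<tau> + 1) / 2) u" "theta2 ((\<tau> + 1) / 2)"])
      fix u h
      have "?c * (theta1 (\<tau> + 1) (u - h) * theta4 (\<tau> + 1) (u + h) +
          theta1 (\<tau> + 1) (u + h) * theta4 (\<tau> + 1) (u - h)) =
          ?c * (theta1 ((\<tau> + 1) / 2) u * theta2 ((\<tau> + 1) / 2) h)"
        using theta1_theta4_exchange[of "\<tau> + 1" u h] assms(1) by simp
      then show "theta1 \<tau> (u - h) * theta j \<tau> (u + h) + theta1 \<tau> (u + h) * theta j \<tau> (u - h) =
          ?c * theta1 ((\<tau> + 1) / 2) u * theta2 ((\<tau> + 1) / 2) h"
        by (simp add: 2 theta_def c[of "u - h"] c[of "u + h"] theta4_modular_shift distrib_left mult.assoc)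
    qed
  next
    case 3
    show thesis
      by (rule that[of "theta1 (\<tau> / 2)" "theta2 (\<tau> / 2)"])
         (use theta1_theta4_exchange[OF assms(1)] in \<open>simp add: 3 theta_def\<close>)
  qed
qed

text \<open>
  With the left side equal to \<open>F(u) G(h)\<close>, taking \<open>h = 0\<close> gives \<open>2 \<theta>\<^sub>1(u) \<theta>\<^sub>j(u) = F(u) G(0)\<close>, and
  taking \<open>u = h\<close> gives \<open>\<theta>\<^sub>1(2h) \<theta>\<^sub>j(0) = F(h) G(h)\<close>, as \<open>\<theta>\<^sub>1(0) = 0\<close>. The claim, cleared of
  denominators, says that \<open>F(u) G(h) \<cdot> F(h) G(0) = F(h) G(h) \<cdot> F(u) G(0)\<close>.
\<close>

lemma theta_exchange:
  assumes "Im \<tau> > 0" "j \<in> {2, 3, 4}" "theta1 \<tau> h \<noteq> 0" "theta j \<tau> h \<noteq> 0"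
  shows "theta1 \<tau> (u - h) * theta j \<tau> (u + h) + theta1 \<tau> (u + h) * theta j \<tau> (u - h) =
    theta1 \<tau> (2 * h) * theta j \<tau> 0 / (theta1 \<tau> h * theta j \<tau> h) * (theta1 \<tau> u * theta j \<tau> u)"
proof -
  obtain F G where FG: "\<And>u h. theta1 \<tau> (u - h) * theta j \<tau> (u + h) +
    theta1 \<tau> (u + h) * theta j \<tau> (u - h) = F u * G h"
    using theta_exchange_separates[OF assms(1,2)] by blast
  have diag: "2 * (theta1 \<tau> w * theta j \<tau> w) = F w * G 0" for w
    using FG[of w 0] by simp
  have "theta1 \<tau> (2 * h) * theta j \<tau> 0 = F h * G h"
    using FG[of h h] by (simp add: theta1_0 flip: mult_2)
  then have "F u * G h * (2 * (theta1 \<tau> h * theta j \<tau> h)) =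
      theta1 \<tau> (2 * h) * theta j \<tau> 0 * (2 * (theta1 \<tau> u * theta j \<tau> u))"
    unfolding diag by simp
  then show ?thesis
    unfolding FG using assms(3,4) by (simp add: field_simps)
qed

section \<open>Factorisation of the eigenfunctions\<close>

lemma form_eq: "form x y = (x $ 1 * y $ 1 + x $ 2 * y $ 2) / 2"
  by (simp add: form_def sum_2)

lemma \<epsilon>_nth [simp]: "\<epsilon> 1 $ 1 = 1" "\<epsilon> 1 $ 2 = 0" "\<epsilon> 2 $ 1 = 0" "\<epsilon> 2 $ 2 = 1"
  by (simp_all add: \<epsilon>_def axis_def)

text \<open>
  The coset of the coroot lattice consists of the integral vectors whose coordinates have the
  parities of those of \<open>\<mu>\<close>. As \<open>\<epsilon>\<^sub>1, \<epsilon>\<^sub>2\<close> are orthogonal with \<open>(\<epsilon>\<^sub>j, \<epsilon>\<^sub>j) = 1/2\<close>, each coordinate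
  contributes a theta series of modulus \<open>2\<tau>\<close>.
\<close>

lemma classical_Theta_eq:
  assumes "Im \<tau> > 0" "\<mu> = of_int r *s \<epsilon> 1 + of_int s *s \<epsilon> 2"
  shows "classical_Theta \<tau> \<mu> x =
    parity_theta (even r) (2 * \<tau>) (x $ 1) * parity_theta (even s) (2 * \<tau>) (x $ 2)"
proof -
  define vec where "vec = (\<lambda>(a, b). of_int a *s \<epsilon> 1 + of_int b *s \<epsilon> 2)"
  let ?P = "parity_class (even r) \<times> parity_class (even s)"
  have vec_nth: "vec p $ 1 = of_int (fst p)" "vec p $ 2 = of_int (snd p)" for p
    by (simp_all add: vec_def split: prod.splits)
  have inj: "inj_on vec ?P"
  proof (rule inj_onI)
    fix p q assume "vec p = vec q"
    then have "vec p $ 1 = vec q $ 1" "vec p $ 2 = vec q $ 2"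
      by simp_all
    then show "p = q"
      by (simp add: vec_nth prod_eq_iff)
  qed
  have coset: "(\<lambda>\<beta>. \<mu> + \<beta>) ` coroot_lattice = vec ` ?P"
  proof (intro equalityI subsetI)
    fix \<gamma> assume "\<gamma> \<in> (\<lambda>\<beta>. \<mu> + \<beta>) ` coroot_lattice"
    then obtain m n :: int where
      "\<gamma> = \<mu> + (of_int m *s (2 *s \<epsilon> 1) + of_int n *s (2 *s \<epsilon> 2))"
      unfolding coroot_lattice_def by blast
    then have "\<gamma> = vec (r + 2 * m, s + 2 * n)"
      by (simp add: assms(2) vec_def vec_eq_iff forall_2)
    moreover have "(r + 2 * m, s + 2 * n) \<in> ?P"
      by (simp add: parity_class_def)
    ultimately show "\<gamma> \<in> vec ` ?P"
      by blast
  next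
    fix \<gamma> assume "\<gamma> \<in> vec ` ?P"
    then obtain a b where ab: "\<gamma> = vec (a, b)" "even a = even r" "even b = even s"
      by (auto simp: parity_class_def)
    have "even (a - r)" "even (b - s)"
      using ab by auto
    then obtain m n where "a - r = 2 * m" "b - s = 2 * n"
      by (elim evenE)
    then have "a = r + 2 * m" "b = s + 2 * n"
      by simp_all
    then have "\<gamma> = \<mu> + (of_int m *s (2 *s \<epsilon> 1) + of_int n *s (2 *s \<epsilon> 2))"
      by (simp add: ab(1) assms(2) vec_def vec_eq_iff forall_2)
    then show "\<gamma> \<in> (\<lambda>\<beta>. \<mu> + \<beta>) ` coroot_lattice"
      unfolding coroot_lattice_def by blast
  qed
  have "exp (2 * of_real pi * \<i> * (form (vec p) x + form (vec p) (vec p) / 2 * \<tau>)) =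
      (case p of (a, b) \<Rightarrow> gauss_term (2 * \<tau>) (x $ 1) a * gauss_term (2 * \<tau>) (x $ 2) b)" for p
    unfolding gauss_term_def exp_add[symmetric] case_prod_beta form_eq vec_nth
    by (rule arg_cong[of _ _ exp]) (simp add: power2_eq_square field_simps)
  then have "classical_Theta \<tau> \<mu> x =
      (\<Sum>\<^sub>\<infinity>(a, b)\<in>?P. gauss_term (2 * \<tau>) (x $ 1) a * gauss_term (2 * \<tau>) (x $ 2) b)"
    unfolding classical_Theta_def coset infsum_reindex[OF inj] o_def by simp
  then show ?thesis
    using has_sum_parity_theta_mult[of "2 * \<tau>" "2 * \<tau>"] assms(1) by (simp add: infsumI)
qed

text \<open>
  The combinations of classical theta functions that define \<open>f\<^sub>1\<close> and \<open>f\<^sub>2\<close> are the right side of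
  the duplication formula at \<open>u\<close> and \<open>v\<close>. Moving both \<open>u\<close> and \<open>v\<close> by \<open>1/2\<close> turns \<open>\<theta>\<^sub>3\<close> into \<open>\<theta>\<^sub>4\<close>; it
  moves \<open>u + v\<close> by a full period, which reverses the sign of the odd series, and fixes \<open>u - v\<close>.
  This yields the difference \<open>f\<^sub>3\<close>.
\<close>

lemma f_fun_eq:
  assumes "Im \<tau> > 0" "i \<in> {1, 2, 3}"
  shows "f_fun \<tau> i x =
    theta (i + 1) \<tau> ((x $ 1 + x $ 2) / 2) * theta (i + 1) \<tau> ((x $ 1 - x $ 2) / 2)"
proof -
  let ?u = "(x $ 1 + x $ 2) / 2" and ?v = "(x $ 1 - x $ 2) / 2"
  have uv: "?u + ?v = x $ 1" "?u - ?v = x $ 2"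
    "(?u + 1/2) + (?v + 1/2) = x $ 1 + 1" "(?u + 1/2) - (?v + 1/2) = x $ 2"
    by (simp_all add: field_simps)
  have \<Theta>:
    "classical_Theta \<tau> 0 x = parity_theta True (2 * \<tau>) (x $ 1) * parity_theta True (2 * \<tau>) (x $ 2)"
    "classical_Theta \<tau> (\<epsilon> 1) x
      = parity_theta False (2 * \<tau>) (x $ 1) * parity_theta True (2 * \<tau>) (x $ 2)"
    "classical_Theta \<tau> (\<epsilon> 2) x
      = parity_theta True (2 * \<tau>) (x $ 1) * parity_theta False (2 * \<tau>) (x $ 2)"
    "classical_Theta \<tau> (\<epsilon> 1 + \<epsilon> 2) x
      = parity_theta False (2 * \<tau>) (x $ 1) * parity_theta False (2 * \<tau>) (x $ 2)"
    using classical_Theta_eq[OF assms(1), of _ 0 0] classical_Theta_eq[OF assms(1), of _ 1 0]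
      classical_Theta_eq[OF assms(1), of _ 0 1] classical_Theta_eq[OF assms(1), of _ 1 1]
    by simp_all
  note dup = parity_theta_duplication[OF assms(1)]
  consider "i = 1" | "i = 2" | "i = 3"
    using assms(2) by auto
  then show ?thesis
  proof cases
    case 1
    then show ?thesis
      using dup[of False ?u ?v] unfolding uv by (simp add: f_fun_def theta_def \<Theta> theta2_eq_parity_theta)
  next
    case 2
    then show ?thesis
      using dup[of True ?u ?v] unfolding uv by (simp add: f_fun_def theta_def \<Theta> theta3_eq_parity_theta)
  next
    case 3
    then show ?thesis
      using dup[of True "?u + 1/2" "?v + 1/2"] unfolding uv parity_theta_add_1
      by (simp add: f_fun_def theta_def \<Theta> theta4_eq_parity_theta)
  qed
qed

section \<open>The difference operators\<close>

lemma \<epsilon>_distinct: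
  "\<epsilon> 1 \<noteq> \<epsilon> 2" "\<epsilon> 1 \<noteq> - \<epsilon> 1" "\<epsilon> 1 \<noteq> - \<epsilon> 2" "\<epsilon> 2 \<noteq> - \<epsilon> 2" "- \<epsilon> 1 \<noteq> \<epsilon> 2"
  by (auto simp: vec_eq_iff forall_2)

lemma sum_P1: "sum F P1 = F (\<epsilon> 1) + F (- \<epsilon> 1) + F (\<epsilon> 2) + F (- \<epsilon> 2)"
  using \<epsilon>_distinct by (simp add: P1_def add.assoc)

lemma P1_nonparallel:
  "{q \<in> P1. q \<noteq> \<epsilon> 1 \<and> q \<noteq> - \<epsilon> 1} = {\<epsilon> 2, - \<epsilon> 2}"
  "{q \<in> P1. q \<noteq> - \<epsilon> 1 \<and> q \<noteq> \<epsilon> 1} = {\<epsilon> 2, - \<epsilon> 2}"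
  "{q \<in> P1. q \<noteq> \<epsilon> 2 \<and> q \<noteq> - \<epsilon> 2} = {\<epsilon> 1, - \<epsilon> 1}"
  "{q \<in> P1. q \<noteq> - \<epsilon> 2 \<and> q \<noteq> \<epsilon> 2} = {\<epsilon> 1, - \<epsilon> 1}"
  using \<epsilon>_distinct by (auto simp: P1_def)

text \<open>
  The shifts by \<open>\<plusminus>2\<epsilon>\<^sub>1\<close> and \<open>\<plusminus>2\<epsilon>\<^sub>2\<close> move \<open>(u, v)\<close> by \<open>\<plusminus>(h, h)\<close> and \<open>\<plusminus>(h, - h)\<close>, so every choice of
  signs for the two coordinates occurs once. The coefficient of each choice is a product over the
  coordinates, since the roots \<open>p + q\<close> take the values \<open>\<plusminus>u\<close> and \<open>\<plusminus>v\<close>.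
\<close>

lemma M1_of_product:
  fixes g :: "complex \<Rightarrow> complex" and \<tau> h :: complex
  assumes f: "\<And>x. f x = g ((x $ 1 + x $ 2) / 2) * g ((x $ 1 - x $ 2) / 2)"
  defines "A \<equiv> \<lambda>w. (theta1 \<tau> (w - h) * g (w + h) + theta1 \<tau> (w + h) * g (w - h)) / theta1 \<tau> w"
  shows "M1 \<tau> h f x = A ((x $ 1 + x $ 2) / 2) * A ((x $ 1 - x $ 2) / 2)"
proof -
  define u v where "u = (x $ 1 + x $ 2) / 2" and "v = (x $ 1 - x $ 2) / 2"
  have x: "x $ 1 = u + v" "x $ 2 = u - v"
    by (simp_all add: u_def v_def field_simps)
  have forms: "form x (\<epsilon> 1 + \<epsilon> 2) = u" "form x (\<epsilon> 1 - \<epsilon> 2) = v"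
    "form x (- \<epsilon> 1 + \<epsilon> 2) = - v" "form x (- \<epsilon> 1 - \<epsilon> 2) = - u"
    "form x (\<epsilon> 2 + \<epsilon> 1) = u" "form x (\<epsilon> 2 - \<epsilon> 1) = - v"
    "form x (- \<epsilon> 2 + \<epsilon> 1) = v" "form x (- \<epsilon> 2 - \<epsilon> 1) = - u"
    by (simp_all add: form_eq x)
  have shifts: "shift h (2 *s \<epsilon> 1) f x = g (u + h) * g (v + h)"
    "shift h (- (2 *s \<epsilon> 1)) f x = g (u - h) * g (v - h)"
    "shift h (2 *s \<epsilon> 2) f x = g (u + h) * g (v - h)"
    "shift h (- (2 *s \<epsilon> 2)) f x = g (u - h) * g (v + h)"
    by (simp_all add: shift_def f x add_divide_distrib diff_divide_distrib algebra_simps)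
  have neg: "theta1 \<tau> (- w - h) / theta1 \<tau> (- w) = theta1 \<tau> (w + h) / theta1 \<tau> w" for w
    using theta1_minus[of \<tau> "w + h"] theta1_minus[of \<tau> w] by simp
  have "M1 \<tau> h f x =
      theta1 \<tau> (u - h) / theta1 \<tau> u * (theta1 \<tau> (v - h) / theta1 \<tau> v) * (g (u + h) * g (v + h)) +
      theta1 \<tau> (v + h) / theta1 \<tau> v * (theta1 \<tau> (u + h) / theta1 \<tau> u) * (g (u - h) * g (v - h)) +
      theta1 \<tau> (u - h) / theta1 \<tau> u * (theta1 \<tau> (v + h) / theta1 \<tau> v) * (g (u + h) * g (v - h)) +
      theta1 \<tau> (v - h) / theta1 \<tau> v * (theta1 \<tau> (u + h) / theta1 \<tau> u) * (g (u - h) * g (v + h))"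
    unfolding M1_def sum_P1 using \<epsilon>_distinct
    by (simp add: P1_nonparallel theta_def forms shifts neg)
  then show ?thesis
    unfolding A_def u_def[symmetric] v_def[symmetric]
    by (simp add: add_divide_distrib algebra_simps)
qed

text \<open>
  The double shifts move only one of \<open>u\<close> and \<open>v\<close>, by \<open>\<plusminus>2h\<close>, and the coefficients of the
  term indexed by \<open>(p, q)\<close> depend on the moved coordinate alone.
\<close>

lemma M2_of_product:
  fixes g :: "complex \<Rightarrow> complex" and \<tau> h :: complex
  assumes f: "\<And>x. f x = g ((x $ 1 + x $ 2) / 2) * g ((x $ 1 - x $ 2) / 2)"
  defines "D \<equiv> \<lambda>w.
    theta1 \<tau> (w - h) / theta1 \<tau> (w + h) * g (w + 2 * h) +
    theta1 \<tau> (w + h) / theta1 \<tau> (w - h) * g (w - 2 * h) +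
    (theta1 \<tau> (w - h) * theta1 \<tau> (w + 2 * h) / (theta1 \<tau> w * theta1 \<tau> (w + h)) +
     theta1 \<tau> (w + h) * theta1 \<tau> (w - 2 * h) / (theta1 \<tau> w * theta1 \<tau> (w - h))) * g w"
  shows "M2 \<tau> h f x =
    D ((x $ 1 + x $ 2) / 2) * g ((x $ 1 - x $ 2) / 2) +
    g ((x $ 1 + x $ 2) / 2) * D ((x $ 1 - x $ 2) / 2)"
proof -
  define u v where "u = (x $ 1 + x $ 2) / 2" and "v = (x $ 1 - x $ 2) / 2"
  have x: "x $ 1 = u + v" "x $ 2 = u - v"
    by (simp_all add: u_def v_def field_simps)
  have forms: "form x (\<epsilon> 1 + \<epsilon> 2) = u" "form x (\<epsilon> 1 - \<epsilon> 2) = v"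
    "form x (- \<epsilon> 1 + \<epsilon> 2) = - v" "form x (- \<epsilon> 1 - \<epsilon> 2) = - u"
    "form x (\<epsilon> 2 - \<epsilon> 1) = - v"
    by (simp_all add: form_eq x)
  have shifts:
    "shift h (2 *s \<epsilon> 1) (shift h (2 *s \<epsilon> 2) f) x = g (u + 2 * h) * g v"
    "shift h (2 *s \<epsilon> 1) (shift h (- (2 *s \<epsilon> 2)) f) x = g u * g (v + 2 * h)"
    "shift h (- (2 *s \<epsilon> 1)) (shift h (2 *s \<epsilon> 2) f) x = g u * g (v - 2 * h)"
    "shift h (- (2 *s \<epsilon> 1)) (shift h (- (2 *s \<epsilon> 2)) f) x = g (u - 2 * h) * g v"
    by (simp_all add: shift_def f x add_divide_distrib diff_divide_distrib algebra_simps)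
  have fx: "f x = g u * g v"
    by (simp add: f u_def v_def)
  have neg: "theta1 \<tau> (- w - h) = - theta1 \<tau> (w + h)" "theta1 \<tau> (h - w) = - theta1 \<tau> (w - h)"
    "theta1 \<tau> (2 * h - w) = - theta1 \<tau> (w - 2 * h)" for w
    by (simp_all flip: theta1_minus)
  have "M2 \<tau> h f x =
      theta1 \<tau> (u - h) / theta1 \<tau> (u + h) * (g (u + 2 * h) * g v) +
      theta1 \<tau> (u - h) * theta1 \<tau> (u + 2 * h) / (theta1 \<tau> u * theta1 \<tau> (u + h)) * (g u * g v) +
      (theta1 \<tau> (v - h) / theta1 \<tau> (v + h) * (g u * g (v + 2 * h)) +
      theta1 \<tau> (v - h) * theta1 \<tau> (v + 2 * h) / (theta1 \<tau> v * theta1 \<tau> (v + h)) * (g u * g v)) +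
      (theta1 \<tau> (v + h) / theta1 \<tau> (v - h) * (g u * g (v - 2 * h)) +
      theta1 \<tau> (v + h) * theta1 \<tau> (v - 2 * h) / (theta1 \<tau> v * theta1 \<tau> (v - h)) * (g u * g v) +
      (theta1 \<tau> (u + h) / theta1 \<tau> (u - h) * (g (u - 2 * h) * g v) +
      theta1 \<tau> (u + h) * theta1 \<tau> (u - 2 * h) / (theta1 \<tau> u * theta1 \<tau> (u - h)) * (g u * g v)))"
    unfolding M2_def using \<epsilon>_distinct
    by (simp add: theta_def forms shifts fx neg theta1_minus)
  then show ?thesis
    unfolding D_def u_def[symmetric] v_def[symmetric]
    by (simp add: algebra_simps)
qed

text \<open>
  The terms with the shift \<open>w + 2h\<close> combine, by the exchange identity at \<open>w + h\<close>, to
  \<open>C \<theta>\<^sub>1(w - h) g(w + h) / \<theta>\<^sub>1(w)\<close>, and those with \<open>w - 2h\<close> symmetrically. The exchange identity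
  at \<open>w\<close> evaluates the sum of the two.
\<close>

lemma M2_factor_eigenvalue:
  fixes g :: "complex \<Rightarrow> complex"
  assumes exch: "\<And>w. theta1 \<tau> (w - h) * g (w + h) + theta1 \<tau> (w + h) * g (w - h) =
      C * (theta1 \<tau> w * g w)"
    and nz: "theta1 \<tau> w \<noteq> 0" "theta1 \<tau> (w + h) \<noteq> 0" "theta1 \<tau> (w - h) \<noteq> 0"
  shows "theta1 \<tau> (w - h) / theta1 \<tau> (w + h) * g (w + 2 * h) +
      theta1 \<tau> (w + h) / theta1 \<tau> (w - h) * g (w - 2 * h) +
      (theta1 \<tau> (w - h) * theta1 \<tau> (w + 2 * h) / (theta1 \<tau> w * theta1 \<tau> (w + h)) +
       theta1 \<tau> (w + h) * theta1 \<tau> (w - 2 * h) / (theta1 \<tau> w * theta1 \<tau> (w - h))) * g w =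
      C\<^sup>2 * g w"
proof -
  have "theta1 \<tau> w * g (w + 2 * h) + theta1 \<tau> (w + 2 * h) * g w =
      C * (theta1 \<tau> (w + h) * g (w + h))"
    using exch[of "w + h"] by (simp add: add.assoc flip: mult_2)
  then have plus: "theta1 \<tau> (w - h) / theta1 \<tau> (w + h) * g (w + 2 * h) +
      theta1 \<tau> (w - h) * theta1 \<tau> (w + 2 * h) / (theta1 \<tau> w * theta1 \<tau> (w + h)) * g w =
      C * (theta1 \<tau> (w - h) * g (w + h)) / theta1 \<tau> w"
    using nz by (simp add: divide_simps) algebra
  have "theta1 \<tau> (w - 2 * h) * g w + theta1 \<tau> w * g (w - 2 * h) =
      C * (theta1 \<tau> (w - h) * g (w - h))"
    using exch[of "w - h"] by (simp add: diff_diff_eq flip: mult_2)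
  then have minus: "theta1 \<tau> (w + h) / theta1 \<tau> (w - h) * g (w - 2 * h) +
      theta1 \<tau> (w + h) * theta1 \<tau> (w - 2 * h) / (theta1 \<tau> w * theta1 \<tau> (w - h)) * g w =
      C * (theta1 \<tau> (w + h) * g (w - h)) / theta1 \<tau> w"
    using nz by (simp add: divide_simps) algebra
  have "C * (theta1 \<tau> (w - h) * g (w + h)) / theta1 \<tau> w +
      C * (theta1 \<tau> (w + h) * g (w - h)) / theta1 \<tau> w =
      C * (C * (theta1 \<tau> w * g w)) / theta1 \<tau> w"
    unfolding exch[symmetric] by (simp add: add_divide_distrib distrib_left)
  also have "\<dots> = C\<^sup>2 * g w"
    using nz by (simp add: power2_eq_square)
  finally show ?thesis
    unfolding plus[symmetric] minus[symmetric] by (simp add: algebra_simps)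
qed

theorem theorem4:
  fixes \<tau> h :: complex and i :: nat
  assumes "Im \<tau> > 0"
    and "i \<in> {1, 2, 3}"
    and "theta 1 \<tau> h \<noteq> 0"
    and "theta (i + 1) \<tau> h \<noteq> 0"
  shows "(\<exists>x. f_fun \<tau> i x \<noteq> 0) \<and>
    (\<forall>x\<in>M1_regular \<tau>. M1 \<tau> h (f_fun \<tau> i) x = E1 \<tau> h i * f_fun \<tau> i x) \<and>
    (\<forall>x\<in>M2_regular \<tau> h. M2 \<tau> h (f_fun \<tau> i) x = E2 \<tau> h i * f_fun \<tau> i x)"
proof -
  let ?g = "theta (i + 1) \<tau>"
  define C where "C = theta1 \<tau> (2 * h) * ?g 0 / (theta1 \<tau> h * ?g h)"
  have th1: "theta 1 = theta1"
    by (simp add: theta_def)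
  have f: "f_fun \<tau> i x = ?g ((x $ 1 + x $ 2) / 2) * ?g ((x $ 1 - x $ 2) / 2)" for x
    by (rule f_fun_eq[OF assms(1,2)])
  have E1: "E1 \<tau> h i = C\<^sup>2"
    unfolding E1_def C_def th1 ..
  have exch: "theta1 \<tau> (w - h) * ?g (w + h) + theta1 \<tau> (w + h) * ?g (w - h) =
      C * (theta1 \<tau> w * ?g w)" for w
    unfolding C_def using assms by (intro theta_exchange) (auto simp flip: th1)
  \<comment> \<open>This point has \<open>u = v = h\<close>, where \<open>g\<close> does not vanish by hypothesis.\<close>
  have "f_fun \<tau> i ((2 * h) *s \<epsilon> 1) \<noteq> 0"
    using assms(4) by (simp add: f)
  moreover have "M1 \<tau> h (f_fun \<tau> i) x = E1 \<tau> h i * f_fun \<tau> i x" if "x \<in> M1_regular \<tau>" for x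
  proof -
    define u v where "u = (x $ 1 + x $ 2) / 2" and "v = (x $ 1 - x $ 2) / 2"
    have "\<epsilon> 2 \<noteq> \<epsilon> 1 \<and> \<epsilon> 2 \<noteq> - \<epsilon> 1" "- \<epsilon> 2 \<noteq> \<epsilon> 1 \<and> - \<epsilon> 2 \<noteq> - \<epsilon> 1"
      using \<epsilon>_distinct by auto
    then have "theta1 \<tau> (form x (\<epsilon> 1 + \<epsilon> 2)) \<noteq> 0" "theta1 \<tau> (form x (\<epsilon> 1 + - \<epsilon> 2)) \<noteq> 0"
      using that unfolding M1_regular_def P1_def th1 by blast+
    then have nz: "theta1 \<tau> u \<noteq> 0" "theta1 \<tau> v \<noteq> 0"
      by (simp_all add: form_eq u_def v_def)
    show ?thesis
      unfolding M1_of_product[OF f] exch E1 u_def[symmetric] v_def[symmetric]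
      using nz by (simp add: f power2_eq_square flip: u_def v_def)
  qed
  moreover have "M2 \<tau> h (f_fun \<tau> i) x = E2 \<tau> h i * f_fun \<tau> i x" if "x \<in> M2_regular \<tau> h" for x
  proof -
    define u v where "u = (x $ 1 + x $ 2) / 2" and "v = (x $ 1 - x $ 2) / 2"
    have "theta1 \<tau> (form x (p + q)) \<noteq> 0 \<and> theta1 \<tau> (form x (p + q) + h) \<noteq> 0"
      if "p \<in> {\<epsilon> 1, - \<epsilon> 1}" "q \<in> {\<epsilon> 2, - \<epsilon> 2}" for p q
      using \<open>x \<in> M2_regular \<tau> h\<close> that unfolding M2_regular_def th1 by blast
    from this[of "\<epsilon> 1" "\<epsilon> 2"] this[of "\<epsilon> 1" "- \<epsilon> 2"]
      this[of "- \<epsilon> 1" "\<epsilon> 2"] this[of "- \<epsilon> 1" "- \<epsilon> 2"]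
    have nz: "theta1 \<tau> u \<noteq> 0 \<and> theta1 \<tau> (u + h) \<noteq> 0 \<and> theta1 \<tau> (- u + h) \<noteq> 0"
      "theta1 \<tau> v \<noteq> 0 \<and> theta1 \<tau> (v + h) \<noteq> 0 \<and> theta1 \<tau> (- v + h) \<noteq> 0"
      by (simp_all add: form_eq u_def v_def minus_divide_left)
    \<comment> \<open>The negative roots supply the denominators at \<open>u - h\<close> and \<open>v - h\<close>, since \<open>\<theta>\<^sub>1\<close> is odd.\<close>
    have nz': "theta1 \<tau> (u - h) \<noteq> 0" "theta1 \<tau> (v - h) \<noteq> 0"
      using nz theta1_minus[of \<tau> "u - h"] theta1_minus[of \<tau> "v - h"] by simp_all
    note D = M2_factor_eigenvalue[where g = ?g, OF exch]
    have "M2 \<tau> h (f_fun \<tau> i) x = C\<^sup>2 * ?g u * ?g v + ?g u * (C\<^sup>2 * ?g v)"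
      unfolding M2_of_product[OF f] u_def[symmetric] v_def[symmetric]
      using D[of u] D[of v] nz nz' by simp
    then show ?thesis
      by (simp add: f E2_def E1 flip: u_def v_def)
  qed
  ultimately show ?thesis
    by blast
qed

end
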